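(* Let $P\subseteq\mathbb{R}^n$ be nonempty, closed and convex, and let $X\subseteq\mathbb{R}^n_+$ be closed and convex. Let $c,t$ be functions that are differentiable and strongly convex, with moduli $\mu_c>0$ and $\mu_t>0$ respectively, on an open convex set containing $X$. Let $u$ be a function such that $-u$ is convex, and let $M>0$. For $p\in P$ let $S(p)$ and $D(p)$ denote the optimal solutions (taken to exist and be unique for every $p\in P$) of the parametric programs $$\max\{p^Tx-c(x): x\in X\},\qquad \min\{p^Tx+t(x): x\in X,\ u(x)\ge M\},$$ respectively. Put $F(p):=S(p)-D(p)$ for $p\in P$, $\mu_F:=\tfrac12\min\{\mu_c,\mu_t\}$, choose $\eta$ with $0\le\eta\le 2\mu_F$, and define $$T(p):=P_P\big(p-\eta F(p)\big),\qquad Fix(T):=\{p\in P: T(p)=p\}.$$ Let $f$ be a strongly convex continuously differentiable function on $\mathbb{R}^n$, and consider the problem $$(BOP)\qquad \min f(p)\quad\text{s.t. } p\in Fix(T),$$ where $Fix(T)$ is taken to be nonempty, so that (BOP) has a unique optimal solution. Let $\{\lambda_k\}$ and $\{\alpha_k\}$ be two sequences of positive numbers decreasing to zero such that $$\sum_{k=1}^{\infty}\lambda_k\alpha_k=+\infty,\qquad \sum_{k=1}^{\infty}|\lambda_{k+1}-\lambda_k|<+\infty,\qquad \sum_{k=1}^{\infty}|\alpha_{k+1}-\alpha_k|<+\infty.$$ Consider the following algorithm. Pick $p^1\in P$. At iteration $k=1,2,\dots$, having $p^k\in P$ and $g^k=\nabla f(p^k)$, compute $$q^k:=\operatorname{argmin}\Big\{\langle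 g^k,y-p^k\rangle+\frac{1}{2\alpha_k}\|y-p^k\|^2: y\in P\Big\}=P_P\big(p^k-\alpha_kg^k\big)$$ and define $$p^{k+1}:=\lambda_kq^k+(1-\lambda_k)T(p^k).$$ If $p^k=q^k=p^{k+1}$, terminate; otherwise increase $k$ by one and go to iteration $k$. Then: (i) If the algorithm terminates at some iteration $k$, then $p^k$ is the solution of (BOP). (ii) If the algorithm does not terminate, then it generates an infinite sequence $\{p^k\}$ that converges to the unique solution of (BOP).
   Context: $\mathbb{R}^n$ carries the Euclidean inner product $\langle\cdot,\cdot\rangle$ and norm $\|\cdot\|$, and $\mathbb{R}^n_+$ is the nonnegative orthant. For a nonempty closed convex set $P\subseteq\mathbb{R}^n$, $P_P(x)$ denotes the metric projection of $x\in\mathbb{R}^n$ onto $P$, i.e. the unique point of $P$ nearest to $x$. A function $h$ is strongly convex with modulus $\gamma>0$ on a convex set $C$ if $$h(\lambda x+(1-\lambda)y)\le\lambda h(x)+(1-\lambda)h(y)-\gamma\lambda(1-\lambda)\|x-y\|^2\quad\text{for all } x,y\in C,\ \lambda\in[0,1];$$ it is strongly convex on $C$ if this holds for some $\gamma>0$. Interpretation (not needed for the claim): $p$ is a price vector, and a point $p^*\in P$ is an equilibrium price if $\langle F(p^* ),p-p^*\rangle\ge0$ for all $p\in P$; a typical choice is $f(p)=\|p-p^0\|^2$, where $p^0$ is a guessed or desired equilibrium price.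
   Formalization: Three conditions are added, as the claim fails without them: λ_k ≤ 1 for all k (so the iterates stay in P); in (i), λ_k ≠ 1 at the terminating iteration; in (ii), either ‖∇f(x)‖ ≤ L(1+‖x‖) on P for some L, or {p^k} is bounded. *)

theory Defs
  imports "HOL-Analysis.Analysis"
begin

text \<open>The modulus follows the convention without the factor 1/2: the correction term is
  \<open>\<gamma> * l * (1 - l) * (norm (x - y))\<^sup>2\<close>.\<close>

definition strongly_convex_on :: "'a::real_normed_vector set \<Rightarrow> real \<Rightarrow> ('a \<Rightarrow> real) \<Rightarrow> bool" where
  "strongly_convex_on C \<gamma> h \<longleftrightarrow> \<gamma> > 0 \<and> convex C \<and>
     (\<forall>x\<in>C. \<forall>y\<in>C. \<forall>l\<in>{0..1}.
        h (l *\<^sub>R x + (1 - l) *\<^sub>R y)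
          \<le> l * h x + (1 - l) * h y - \<gamma> * l * (1 - l) * (norm (x - y))\<^sup>2)"

definition supply_opt :: "(real^'n) set \<Rightarrow> (real^'n \<Rightarrow> real) \<Rightarrow> real^'n \<Rightarrow> real^'n \<Rightarrow> bool" where
  "supply_opt X c p = is_arg_max (\<lambda>x. p \<bullet> x - c x) (\<lambda>x. x \<in> X)"

definition demand_opt ::
  "(real^'n) set \<Rightarrow> (real^'n \<Rightarrow> real) \<Rightarrow> (real^'n \<Rightarrow> real) \<Rightarrow> real \<Rightarrow> real^'n \<Rightarrow> real^'n \<Rightarrow> bool" where
  "demand_opt X t u M p = is_arg_min (\<lambda>x. p \<bullet> x + t x) (\<lambda>x. x \<in> X \<and> u x \<ge> M)"

text \<open>The descriptions below are meaningful only at prices where the optimal solutions exist and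
  are unique.\<close>

definition supply_fun :: "(real^'n) set \<Rightarrow> (real^'n \<Rightarrow> real) \<Rightarrow> real^'n \<Rightarrow> real^'n" where
  "supply_fun X c p = (THE x. supply_opt X c p x)"

definition demand_fun ::
  "(real^'n) set \<Rightarrow> (real^'n \<Rightarrow> real) \<Rightarrow> (real^'n \<Rightarrow> real) \<Rightarrow> real \<Rightarrow> real^'n \<Rightarrow> real^'n" where
  "demand_fun X t u M p = (THE x. demand_opt X t u M p x)"

definition proj_step :: "(real^'n) set \<Rightarrow> real \<Rightarrow> (real^'n \<Rightarrow> real^'n) \<Rightarrow> real^'n \<Rightarrow> real^'n" where
  "proj_step P \<eta> F p = closest_point P (p - \<eta> *\<^sub>R F p)"

definition Fix :: "'a set \<Rightarrow> ('a \<Rightarrow> 'a) \<Rightarrow> 'a set" where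
  "Fix P T = {p \<in> P. T p = p}"

definition BOP_solution :: "('a \<Rightarrow> real) \<Rightarrow> 'a set \<Rightarrow> ('a \<Rightarrow> 'a) \<Rightarrow> 'a \<Rightarrow> bool" where
  "BOP_solution f P T = is_arg_min f (\<lambda>p. p \<in> Fix P T)"

text \<open>Iterations are numbered from 1; the values of the sequences at index 0 are irrelevant.
  Since \<open>p\<close> and \<open>q\<close> are total functions, the iteration constrains them only up to the iteration
  at which the stopping test succeeds for the first time.\<close>

definition stop_test :: "(nat \<Rightarrow> 'a) \<Rightarrow> (nat \<Rightarrow> 'a) \<Rightarrow> nat \<Rightarrow> bool" where
  "stop_test p q k \<longleftrightarrow> p k = q k \<and> q k = p (Suc k)"

definition reaches :: "(nat \<Rightarrow> 'a) \<Rightarrow> (nat \<Rightarrow> 'a) \<Rightarrow> nat \<Rightarrow> bool" where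
  "reaches p q k \<longleftrightarrow> 1 \<le> k \<and> (\<forall>j. 1 \<le> j \<and> j < k \<longrightarrow> \<not> stop_test p q j)"

definition terminates_at :: "(nat \<Rightarrow> 'a) \<Rightarrow> (nat \<Rightarrow> 'a) \<Rightarrow> nat \<Rightarrow> bool" where
  "terminates_at p q k \<longleftrightarrow> reaches p q k \<and> stop_test p q k"

definition algorithm_run ::
  "(real^'n) set \<Rightarrow> (real^'n \<Rightarrow> real^'n) \<Rightarrow> (real^'n \<Rightarrow> real^'n) \<Rightarrow> (nat \<Rightarrow> real) \<Rightarrow> (nat \<Rightarrow> real)
     \<Rightarrow> (nat \<Rightarrow> real^'n) \<Rightarrow> (nat \<Rightarrow> real^'n) \<Rightarrow> bool" where
  "algorithm_run P grad T lam alp p q \<longleftrightarrow> p 1 \<in> P \<and>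
     (\<forall>k. reaches p q k \<longrightarrow>
        is_arg_min (\<lambda>y. grad (p k) \<bullet> (y - p k) + 1 / (2 * alp k) * (norm (y - p k))\<^sup>2)
          (\<lambda>y. y \<in> P) (q k) \<and>
        p (Suc k) = lam k *\<^sub>R q k + (1 - lam k) *\<^sub>R T (p k))"

text \<open>The argmin in the iteration is the projected gradient step.\<close>

lemma prox_argmin_iff_closest_point:
  fixes g x y :: "'a::euclidean_space"
  assumes P: "closed P" "convex P" "P \<noteq> {}" and a: "(a::real) > 0"
  shows "is_arg_min (\<lambda>y. g \<bullet> (y - x) + 1 / (2 * a) * (norm (y - x))\<^sup>2) (\<lambda>y. y \<in> P) y
           \<longleftrightarrow> y = closest_point P (x - a *\<^sub>R g)"
proof -
  define h where "h = (\<lambda>y. g \<bullet> (y - x) + 1 / (2 * a) * (norm (y - x))\<^sup>2)"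
  have h: "h z = 1 / (2 * a) * (dist (x - a *\<^sub>R g) z)\<^sup>2 - a / 2 * (g \<bullet> g)" for z
  proof -
    have "(dist (x - a *\<^sub>R g) z)\<^sup>2 = (norm (z - x))\<^sup>2 + 2 * a * (g \<bullet> (z - x)) + a\<^sup>2 * (g \<bullet> g)"
      unfolding dist_norm power2_norm_eq_inner
      by (simp add: inner_diff_left inner_diff_right inner_commute algebra_simps power2_eq_square)
    with a show ?thesis by (simp add: h_def field_simps power2_eq_square)
  qed
  have le: "h z \<le> h w \<longleftrightarrow> dist (x - a *\<^sub>R g) z \<le> dist (x - a *\<^sub>R g) w" for z w
    using a by (simp add: h divide_le_cancel abs_le_square_iff[symmetric])
  have "is_arg_min h (\<lambda>y. y \<in> P) y
          \<longleftrightarrow> y \<in> P \<and> (\<forall>z\<in>P. dist (x - a *\<^sub>R g) y \<le> dist (x - a *\<^sub>R g) z)"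
    by (auto simp: is_arg_min_linorder le)
  also have "\<dots> \<longleftrightarrow> y = closest_point P (x - a *\<^sub>R g)"
    using closest_point_unique[OF P(2,1)] closest_point_in_set[OF P(1,3)] closest_point_le[OF P(1)]
    by blast
  finally show ?thesis by (simp add: h_def)
qed

text \<open>Two conditions below have no counterpart in the usual phrasing of the result and delimit
  where it holds. The weights satisfy \<open>lam k \<le> 1\<close>, which keeps the iterates in \<open>P\<close>, and stopping is
  informative only if \<open>lam k \<noteq> 1\<close>, since otherwise the step does not involve \<open>T\<close>. For convergence,
  the iterates must not blow up under the explicit gradient step: with \<open>P\<close> the real line,
  \<open>\<eta> = 0\<close>, \<open>f x = x^4 + x^2\<close>, \<open>lam k * alp k = 1/(k+1)\<close> and \<open>p 1 = 100\<close> they diverge. The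
  following holds if \<open>P\<close> is bounded, or if the gradient is at most linearly growing on \<open>P\<close>
  (in particular if it is Lipschitz), or if the iterates are known to be bounded.\<close>

definition no_blow_up ::
  "'a::real_normed_vector set \<Rightarrow> ('a \<Rightarrow> 'a) \<Rightarrow> (nat \<Rightarrow> 'a) \<Rightarrow> bool" where
  "no_blow_up P grad p \<longleftrightarrow>
     (\<exists>L. \<forall>x\<in>P. norm (grad x) \<le> L * (1 + norm x)) \<or> bounded (p ` {1..})"

end

theory Submission
  imports Defs
begin

text \<open>
  Write \<open>\<mu>\<close> for the smaller of the two moduli. A minimizer of a strongly convex function plus a
  linear form depends cocoercively on the form, so the excess supply \<open>F\<close> satisfies
  \<open>\<mu> * (norm (F x - F y))\<^sup>2 \<le> (x - y) \<bullet> (F x - F y)\<close> (\<open>excess_supply_cocoercive\<close>). Since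
  \<open>\<eta> \<le> \<mu>\<close>, the step \<open>x - \<eta> *\<^sub>R F x\<close> is firmly nonexpansive, as is the projection onto \<open>P\<close>.
  Their composition \<open>T\<close> is thus averaged: it does not just avoid increasing the distance to a fixed
  point, it decreases the squared distance by at least half of the squared residual
  (\<open>averaged_on_compose\<close>). In particular its fixed points form a closed convex set, on which the
  strongly convex \<open>f\<close> has exactly one minimizer \<open>z\<close>.

  If the algorithm stops at \<open>p k\<close>, then \<open>p k\<close> is fixed by \<open>T\<close> (as \<open>lam k \<noteq> 1\<close>) and by the projected
  gradient step. The latter means that it minimizes \<open>f\<close> over all of \<open>P\<close>.

  If it does not stop, put \<open>a k = (norm (p k - z))\<^sup>2\<close>, \<open>w k = lam k * alp k\<close> and let \<open>r k\<close> be the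
  norm of \<open>p k - T (p k)\<close>. Convexity of the squared norm, nonexpansiveness of the projection and the
  averagedness of \<open>T\<close> give (\<open>averaged_gradient_step\<close>)

  \<open>a (Suc k) \<le> a k - 2 * w k * (grad (p k) \<bullet> (p k - z)) + w k * alp k * (norm (grad (p k)))\<^sup>2
     - (1 - lam k) / 2 * (r k)\<^sup>2\<close>.

  Strong convexity bounds \<open>grad (p k) \<bullet> (p k - z)\<close> below by \<open>\<sigma> * a k + grad z \<bullet> (p k - z)\<close>, where
  \<open>\<sigma>\<close> is twice the modulus of \<open>f\<close>. The last inner product is nonnegative at fixed points of \<open>T\<close>,
  hence by compactness almost nonnegative wherever the residual is small
  (\<open>almost_fixed_inner_lower_bound\<close>); where the residual is not small, its square outweighs all terms
  of order \<open>w k\<close>. So for each positive \<open>\<epsilon>\<close>, eventually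
  \<open>a (Suc k) \<le> (1 - 2 * \<sigma> * w k) * a k + 3 * \<epsilon> * w k\<close>, and since the \<open>w k\<close> sum to infinity, \<open>a\<close>
  eventually drops below any level above \<open>3 * \<epsilon> / (2 * \<sigma>)\<close>. The argument needs the iterates to be
  bounded; under linear growth of the gradient this follows from the same recursion.
\<close>

section \<open>Strong convexity\<close>

lemma directional_quotient_tendsto:
  fixes f :: "'a::real_inner \<Rightarrow> real"
  assumes "GDERIV f x :> g"
  shows "((\<lambda>l. (f (x + l *\<^sub>R (y - x)) - f x) / l) \<longlongrightarrow> g \<bullet> (y - x)) (at_right 0)"
proof -
  have f: "(f has_derivative (\<lambda>h. h \<bullet> g)) (at (x + 0 *\<^sub>R (y - x)))"
    using assms by (simp add: gderiv_def)
  have "((\<lambda>l. x + l *\<^sub>R (y - x)) has_derivative (\<lambda>l. l *\<^sub>R (y - x))) (at 0)"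
    by (auto intro!: derivative_eq_intros)
  from has_derivative_compose[OF this f]
  have "((\<lambda>l. f (x + l *\<^sub>R (y - x))) has_real_derivative g \<bullet> (y - x)) (at 0)"
    by (simp add: has_field_derivative_def inner_commute mult_commute_abs)
  then have "((\<lambda>l. (f (x + l *\<^sub>R (y - x)) - f x) / l) \<longlongrightarrow> g \<bullet> (y - x)) (at 0)"
    by (simp add: DERIV_def)
  then show ?thesis
    by (rule tendsto_mono[rotated]) (simp add: at_le)
qed

lemma strongly_convex_on_segment:
  assumes "strongly_convex_on C \<gamma> h" "x \<in> C" "y \<in> C" "0 < l" "l < 1"
  shows "h (x + l *\<^sub>R (y - x)) \<le> h x + l * (h y - h x - \<gamma> * (1 - l) * (norm (y - x))\<^sup>2)"
proof -
  have "l \<in> {0..1}" using assms by simp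
  with assms have "h (l *\<^sub>R y + (1 - l) *\<^sub>R x)
          \<le> l * h y + (1 - l) * h x - \<gamma> * l * (1 - l) * (norm (y - x))\<^sup>2"
    unfolding strongly_convex_on_def by blast
  moreover have "l *\<^sub>R y + (1 - l) *\<^sub>R x = x + l *\<^sub>R (y - x)" by (simp add: algebra_simps)
  ultimately show ?thesis by (simp add: algebra_simps)
qed

lemma strongly_convex_on_gradient:
  assumes sc: "strongly_convex_on C \<gamma> h" and x: "x \<in> C" and y: "y \<in> C"
    and g: "GDERIV h x :> g"
  shows "h x + g \<bullet> (y - x) + \<gamma> * (norm (y - x))\<^sup>2 \<le> h y"
proof -
  have "((\<lambda>l. h y - h x - \<gamma> * (1 - l) * (norm (y - x))\<^sup>2)
          \<longlongrightarrow> h y - h x - \<gamma> * (1 - 0) * (norm (y - x))\<^sup>2) (at_right 0)"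
    by (intro tendsto_intros)
  moreover have "\<forall>\<^sub>F l in at_right 0. (h (x + l *\<^sub>R (y - x)) - h x) / l
      \<le> h y - h x - \<gamma> * (1 - l) * (norm (y - x))\<^sup>2"
    using eventually_at_right_real[OF zero_less_one]
  proof (eventually_elim)
    case (elim l)
    then show ?case
      using strongly_convex_on_segment[OF sc x y, of l]
      by (simp add: pos_divide_le_eq mult.commute[of l])
  qed
  ultimately have "g \<bullet> (y - x) \<le> h y - h x - \<gamma> * (1 - 0) * (norm (y - x))\<^sup>2"
    by (intro tendsto_le[OF trivial_limit_at_right_real _ directional_quotient_tendsto[OF g]])
  then show ?thesis by simp
qed

lemma strongly_convex_on_gradient_monotone:
  assumes sc: "strongly_convex_on C \<gamma> h" and "x \<in> C" "y \<in> C"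
    and "GDERIV h x :> g" "GDERIV h y :> g'"
  shows "2 * \<gamma> * (norm (x - y))\<^sup>2 \<le> (g - g') \<bullet> (x - y)"
  using strongly_convex_on_gradient[OF sc assms(2,3,4)] strongly_convex_on_gradient[OF sc assms(3,2,5)]
  by (simp add: inner_diff_left inner_diff_right norm_minus_commute algebra_simps)

lemma minimizer_variational_inequality:
  assumes K: "convex K" and x: "is_arg_min f (\<lambda>y. y \<in> K) x" and y: "y \<in> K"
    and g: "GDERIV f x :> g"
  shows "0 \<le> g \<bullet> (y - x)"
proof (rule tendsto_lowerbound[OF directional_quotient_tendsto[OF g]])
  show "\<forall>\<^sub>F l in at_right 0. 0 \<le> (f (x + l *\<^sub>R (y - x)) - f x) / l"
    using eventually_at_right_real[OF zero_less_one]
  proof (eventually_elim)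
    case (elim l)
    then have "(1 - l) *\<^sub>R x + l *\<^sub>R y \<in> K"
      using x y convexD_alt[OF K, of x y l] by (simp add: is_arg_min_linorder)
    then have "x + l *\<^sub>R (y - x) \<in> K" by (simp add: algebra_simps)
    with x elim show ?case by (simp add: is_arg_min_linorder)
  qed
qed simp

text \<open>Comparing \<open>z\<close> with points of the segment towards \<open>x\<close> and letting them tend to \<open>z\<close> turns the
  defect in the convexity inequality into quadratic growth.\<close>

lemma strongly_convex_minimizer_growth:
  fixes v :: "'a::real_inner"
  assumes sc: "strongly_convex_on U \<gamma> h" and C: "convex C" "C \<subseteq> U"
    and z: "is_arg_min (\<lambda>x. v \<bullet> x + h x) (\<lambda>x. x \<in> C) z" and x: "x \<in> C"
  shows "v \<bullet> z + h z + \<gamma> * (norm (x - z))\<^sup>2 \<le> v \<bullet> x + h x"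
proof -
  have zC: "z \<in> C" using z by (simp add: is_arg_min_linorder)
  have "((\<lambda>l. v \<bullet> z + h z + \<gamma> * (1 - l) * (norm (x - z))\<^sup>2)
          \<longlongrightarrow> v \<bullet> z + h z + \<gamma> * (1 - 0) * (norm (x - z))\<^sup>2) (at_right 0)"
    by (intro tendsto_intros)
  moreover have "\<forall>\<^sub>F l in at_right 0. v \<bullet> z + h z + \<gamma> * (1 - l) * (norm (x - z))\<^sup>2 \<le> v \<bullet> x + h x"
    using eventually_at_right_real[OF zero_less_one]
  proof (eventually_elim)
    case (elim l)
    then have l: "0 < l" "l < 1" by auto
    have "(1 - l) *\<^sub>R z + l *\<^sub>R x \<in> C"
      using zC x convexD_alt[OF C(1), of z x l] l by simp
    then have "z + l *\<^sub>R (x - z) \<in> C" by (simp add: algebra_simps)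
    with z have "v \<bullet> z + h z \<le> v \<bullet> (z + l *\<^sub>R (x - z)) + h (z + l *\<^sub>R (x - z))"
      by (simp add: is_arg_min_linorder)
    moreover have "h (z + l *\<^sub>R (x - z)) \<le> h z + l * (h x - h z - \<gamma> * (1 - l) * (norm (x - z))\<^sup>2)"
      using strongly_convex_on_segment[OF sc _ _ l] zC x C by blast
    ultimately have "0 \<le> l * (v \<bullet> x - v \<bullet> z + (h x - h z - \<gamma> * (1 - l) * (norm (x - z))\<^sup>2))"
      by (simp add: inner_add_right inner_diff_right algebra_simps)
    with l show ?case by (simp add: zero_le_mult_iff)
  qed
  ultimately have "v \<bullet> z + h z + \<gamma> * (1 - 0) * (norm (x - z))\<^sup>2 \<le> v \<bullet> x + h x"
    by (rule tendsto_upperbound) simp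
  then show ?thesis by simp
qed

text \<open>Each minimizer is a competitor in the problem of the other; the two growth inequalities add up,
  and the values of \<open>h\<close> cancel.\<close>

lemma parametric_minimizer_cocoercive:
  fixes v w :: "'a::real_inner"
  assumes sc: "strongly_convex_on U \<gamma> h" and C: "convex C" "C \<subseteq> U"
    and y: "is_arg_min (\<lambda>x. v \<bullet> x + h x) (\<lambda>x. x \<in> C) y"
    and z: "is_arg_min (\<lambda>x. w \<bullet> x + h x) (\<lambda>x. x \<in> C) z"
  shows "2 * \<gamma> * (norm (y - z))\<^sup>2 \<le> (w - v) \<bullet> (y - z)"
proof -
  have "y \<in> C" "z \<in> C" using y z by (simp_all add: is_arg_min_linorder)
  then show ?thesis
    using strongly_convex_minimizer_growth[OF sc C y, of z]
      strongly_convex_minimizer_growth[OF sc C z, of y]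
    by (simp add: inner_diff_left inner_diff_right norm_minus_commute algebra_simps)
qed

text \<open>By the gradient inequality, a point farther from \<open>x0\<close> than \<open>norm (grad x0) / \<gamma>\<close> has a larger
  value than \<open>x0\<close>, so minimizing over a compact piece of \<open>K\<close> suffices.\<close>

lemma strongly_convex_unique_minimizer:
  fixes f :: "'a::euclidean_space \<Rightarrow> real"
  assumes sc: "strongly_convex_on UNIV \<gamma> f" and grad: "\<And>x. GDERIV f x :> grad x"
    and K: "closed K" "convex K" "K \<noteq> {}"
  shows "\<exists>!x. is_arg_min f (\<lambda>y. y \<in> K) x"
proof -
  have \<gamma>: "\<gamma> > 0" using sc by (simp add: strongly_convex_on_def)
  obtain x0 where x0: "x0 \<in> K" using K by blast
  have cont: "continuous_on UNIV f"
    using grad has_derivative_continuous unfolding gderiv_def continuous_on_eq_continuous_at[OF open_UNIV]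
    by blast
  define S where "S = K \<inter> cball x0 (norm (grad x0) / \<gamma>)"
  have "compact S" unfolding S_def using K by (intro closed_Int_compact) auto
  moreover have x0S: "x0 \<in> S" using x0 \<gamma> by (simp add: S_def)
  ultimately obtain m where m: "m \<in> S" "\<And>y. y \<in> S \<Longrightarrow> f m \<le> f y"
    using continuous_attains_inf[of S f] continuous_on_subset[OF cont] by blast
  have "f m \<le> f y" if y: "y \<in> K" for y
  proof (cases "y \<in> S")
    case False
    then have far: "norm (grad x0) < \<gamma> * norm (y - x0)"
      using y \<gamma> by (simp add: S_def dist_norm norm_minus_commute field_simps)
    have "- (norm (grad x0) * norm (y - x0)) \<le> grad x0 \<bullet> (y - x0)"
      using Cauchy_Schwarz_ineq2[of "grad x0" "y - x0"] by linarith
    moreover have "norm (grad x0) * norm (y - x0) \<le> \<gamma> * norm (y - x0) * norm (y - x0)"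
      using far by (intro mult_right_mono) auto
    ultimately have "f x0 \<le> f y"
      using strongly_convex_on_gradient[OF sc UNIV_I UNIV_I grad, of x0 y]
      by (simp add: power2_eq_square)
    with m(2)[OF x0S] show ?thesis by simp
  qed (rule m)
  with m have "is_arg_min f (\<lambda>y. y \<in> K) m" by (simp add: is_arg_min_linorder S_def)
  moreover have "y = z" if y: "is_arg_min f (\<lambda>y. y \<in> K) y" and z: "is_arg_min f (\<lambda>y. y \<in> K) z" for y z
  proof -
    have "2 * \<gamma> * (norm (y - z))\<^sup>2 \<le> 0"
      using parametric_minimizer_cocoercive[OF sc K(2), of 0 y 0 z] y z by simp
    with \<gamma> show ?thesis by (simp add: mult_le_0_iff)
  qed
  ultimately show ?thesis by blast
qed

section \<open>Averaged maps\<close>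

text \<open>For \<open>\<kappa> = 1\<close> these are the firmly nonexpansive maps. For positive \<open>\<kappa>\<close> the condition says that
  \<open>T\<close> is \<open>1 / (1 + \<kappa>)\<close>-averaged, that is, a convex combination of the identity and a nonexpansive
  map with weight \<open>1 / (1 + \<kappa>)\<close> on the latter. The inequality form is the one that the estimates
  use.\<close>

definition averaged_on :: "'a::real_inner set \<Rightarrow> real \<Rightarrow> ('a \<Rightarrow> 'a) \<Rightarrow> bool" where
  "averaged_on C \<kappa> T \<longleftrightarrow> (\<forall>x\<in>C. \<forall>y\<in>C.
     (norm (T x - T y))\<^sup>2 \<le> (norm (x - y))\<^sup>2 - \<kappa> * (norm ((x - T x) - (y - T y)))\<^sup>2)"

lemma power2_norm_add_le:
  fixes a b :: "'a::real_inner"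
  shows "(norm (a + b))\<^sup>2 \<le> 2 * (norm a)\<^sup>2 + 2 * (norm b)\<^sup>2"
  unfolding power2_norm_eq_inner using inner_ge_zero[of "a - b"]
  by (simp add: inner_add_left inner_add_right inner_diff_left inner_diff_right inner_commute)

text \<open>The two displacements add up to the displacement of the composition; bounding the square of the
  sum by twice the sum of the squares gives the factor 1/2.\<close>

lemma averaged_on_compose:
  assumes S: "averaged_on A 1 S" and T: "averaged_on B 1 T" and SA: "S ` A \<subseteq> B"
  shows "averaged_on A (1/2) (T \<circ> S)"
  unfolding averaged_on_def
proof (intro ballI)
  fix x y assume xy: "x \<in> A" "y \<in> A"
  define a where "a = (x - S x) - (y - S y)"
  define b where "b = (S x - T (S x)) - (S y - T (S y))"
  have "(norm (T (S x) - T (S y)))\<^sup>2 \<le> (norm (S x - S y))\<^sup>2 - (norm b)\<^sup>2"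
    using T SA xy unfolding averaged_on_def b_def by auto
  moreover have "(norm (S x - S y))\<^sup>2 \<le> (norm (x - y))\<^sup>2 - (norm a)\<^sup>2"
    using S xy unfolding averaged_on_def a_def by auto
  moreover have "(x - T (S x)) - (y - T (S y)) = a + b" by (simp add: a_def b_def)
  ultimately show "(norm ((T \<circ> S) x - (T \<circ> S) y))\<^sup>2
      \<le> (norm (x - y))\<^sup>2 - 1/2 * (norm ((x - (T \<circ> S) x) - (y - (T \<circ> S) y)))\<^sup>2"
    using power2_norm_add_le[of a b] by simp
qed

lemma averaged_on_closest_point:
  fixes P :: "'a::euclidean_space set"
  assumes P: "P \<noteq> {}" "closed P" "convex P"
  shows "averaged_on UNIV 1 (closest_point P)"
  unfolding averaged_on_def
proof (intro ballI)
  fix x y :: 'a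
  let ?a = "closest_point P x" and ?b = "closest_point P y"
  have "?a \<in> P" "?b \<in> P" using P by (simp_all add: closest_point_in_set)
  then have "(x - ?a) \<bullet> (?b - ?a) \<le> 0" "(y - ?b) \<bullet> (?a - ?b) \<le> 0"
    using P by (simp_all add: closest_point_dot)
  then show "(norm (?a - ?b))\<^sup>2 \<le> (norm (x - y))\<^sup>2 - 1 * (norm ((x - ?a) - (y - ?b)))\<^sup>2"
    unfolding power2_norm_eq_inner
    by (simp add: inner_diff_left inner_diff_right inner_commute algebra_simps)
qed

text \<open>Expanding the square, the cross term contributes \<open>- 2 * \<eta> * ((x - y) \<bullet> (F x - F y))\<close>. Half of it
  pays for the quadratic term and the other half is the gain; each half needs \<open>\<eta> \<le> \<mu>\<close>.\<close>

lemma averaged_on_cocoercive_step: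
  assumes F: "\<And>x y. x \<in> C \<Longrightarrow> y \<in> C \<Longrightarrow> \<mu> * (norm (F x - F y))\<^sup>2 \<le> (x - y) \<bullet> (F x - F y)"
    and \<eta>: "0 \<le> \<eta>" "\<eta> \<le> \<mu>"
  shows "averaged_on C 1 (\<lambda>x. x - \<eta> *\<^sub>R F x)"
  unfolding averaged_on_def
proof (intro ballI)
  fix x y assume "x \<in> C" "y \<in> C"
  then have "\<mu> * (norm (F x - F y))\<^sup>2 \<le> (x - y) \<bullet> (F x - F y)" by (rule F)
  moreover have "\<eta> * (norm (F x - F y))\<^sup>2 \<le> \<mu> * (norm (F x - F y))\<^sup>2"
    using \<eta> by (intro mult_right_mono) auto
  ultimately have *: "\<eta> * (\<eta> * (norm (F x - F y))\<^sup>2) \<le> \<eta> * ((x - y) \<bullet> (F x - F y))"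
    using \<eta> by (intro mult_left_mono) auto
  let ?d = "x - y" and ?e = "F x - F y"
  have 1: "x - \<eta> *\<^sub>R F x - (y - \<eta> *\<^sub>R F y) = ?d - \<eta> *\<^sub>R ?e"
    and 2: "(x - (x - \<eta> *\<^sub>R F x)) - (y - (y - \<eta> *\<^sub>R F y)) = \<eta> *\<^sub>R ?e"
    by (simp_all add: algebra_simps)
  have "(norm (?d - \<eta> *\<^sub>R ?e))\<^sup>2 = (norm ?d)\<^sup>2 - 2 * (\<eta> * (?d \<bullet> ?e)) + \<eta> * (\<eta> * (norm ?e)\<^sup>2)"
    unfolding power2_norm_eq_inner
    by (simp add: inner_diff_left[of ?d] inner_diff_right[of _ ?d] inner_commute)
  with * show "(norm (x - \<eta> *\<^sub>R F x - (y - \<eta> *\<^sub>R F y)))\<^sup>2 \<le> (norm (x - y))\<^sup>2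
      - 1 * (norm ((x - (x - \<eta> *\<^sub>R F x)) - (y - (y - \<eta> *\<^sub>R F y))))\<^sup>2"
    unfolding 1 2 by (simp add: power_mult_distrib power2_eq_square[of \<eta>])
qed

lemma averaged_on_continuous:
  assumes T: "averaged_on C \<kappa> T" and \<kappa>: "0 \<le> \<kappa>"
  shows "continuous_on C T"
proof -
  have "dist (T x) (T y) \<le> 1 * dist x y" if "x \<in> C" "y \<in> C" for x y
  proof -
    have "0 \<le> \<kappa> * (norm ((x - T x) - (y - T y)))\<^sup>2" using \<kappa> by simp
    moreover have "(norm (T x - T y))\<^sup>2 \<le> (norm (x - y))\<^sup>2 - \<kappa> * (norm ((x - T x) - (y - T y)))\<^sup>2"
      using T that unfolding averaged_on_def by blast
    ultimately have "(norm (T x - T y))\<^sup>2 \<le> (norm (x - y))\<^sup>2" by linarith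
    then show ?thesis by (simp add: dist_norm power2_le_iff_abs_le)
  qed
  then have "1-lipschitz_on C T" by (intro lipschitz_onI) auto
  then show ?thesis by (rule lipschitz_on_continuous_on)
qed

lemma averaged_on_fixed_point:
  assumes "averaged_on C \<kappa> T" "x \<in> C" "y \<in> Fix C T"
  shows "(norm (T x - y))\<^sup>2 \<le> (norm (x - y))\<^sup>2 - \<kappa> * (norm (x - T x))\<^sup>2"
proof -
  have y: "y \<in> C" "T y = y" using assms(3) by (simp_all add: Fix_def)
  from assms(1,2) y(1) have "(norm (T x - T y))\<^sup>2
      \<le> (norm (x - y))\<^sup>2 - \<kappa> * (norm ((x - T x) - (y - T y)))\<^sup>2"
    unfolding averaged_on_def by blast
  then show ?thesis unfolding y(2) by simp
qed

lemma power2_norm_convex_combination: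
  fixes a b :: "'a::real_inner"
  shows "(norm (l *\<^sub>R a + (1 - l) *\<^sub>R b))\<^sup>2
           = l * (norm a)\<^sup>2 + (1 - l) * (norm b)\<^sup>2 - l * (1 - l) * (norm (a - b))\<^sup>2"
  unfolding power2_norm_eq_inner
  by (simp add: inner_add_left inner_add_right inner_diff_left inner_diff_right inner_commute
      algebra_simps)

text \<open>A point \<open>z\<close> of a segment is determined by its distances to the two ends, and \<open>T z\<close> is no farther
  from either end if both are fixed. The identity for the squared norm of a convex combination makes
  this quantitative: it expresses the distance from \<open>z\<close> by the distances from the ends.\<close>

lemma convex_Fix:
  assumes C: "convex C" and T: "averaged_on C \<kappa> T" and \<kappa>: "0 \<le> \<kappa>"
  shows "convex (Fix C T)"
  unfolding convex_alt
proof (intro ballI allI impI)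
  fix x y and l :: real
  assume x: "x \<in> Fix C T" and y: "y \<in> Fix C T" and l: "0 \<le> l \<and> l \<le> 1"
  define z where "z = (1 - l) *\<^sub>R x + l *\<^sub>R y"
  have z: "z \<in> C"
    using convexD_alt[OF C, of x y l] x y l by (simp add: z_def Fix_def)
  have n: "(norm (T z - w))\<^sup>2 \<le> (norm (z - w))\<^sup>2" if "w \<in> Fix C T" for w
    using averaged_on_fixed_point[OF T z that] \<kappa> by (smt (verit) mult_nonneg_nonneg zero_le_power2)
  have e: "l *\<^sub>R (w - y) + (1 - l) *\<^sub>R (w - x) = w - z" for w
    by (simp add: z_def algebra_simps)
  have "(norm (T z - z))\<^sup>2 = l * (norm (T z - y))\<^sup>2 + (1 - l) * (norm (T z - x))\<^sup>2
      - l * (1 - l) * (norm (T z - y - (T z - x)))\<^sup>2"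
    unfolding e[symmetric] by (rule power2_norm_convex_combination)
  also have "\<dots> \<le> l * (norm (z - y))\<^sup>2 + (1 - l) * (norm (z - x))\<^sup>2
      - l * (1 - l) * (norm (z - y - (z - x)))\<^sup>2"
    using mult_left_mono[OF n[OF y], of l] mult_left_mono[OF n[OF x], of "1 - l"] l by simp
  also have "\<dots> = (norm (z - z))\<^sup>2"
    unfolding e[of z, symmetric] by (rule power2_norm_convex_combination[symmetric])
  finally show "(1 - l) *\<^sub>R x + l *\<^sub>R y \<in> Fix C T"
    using z by (simp add: Fix_def z_def)
qed

lemma closed_Fix:
  fixes C :: "'a::real_normed_vector set"
  assumes "closed C" "continuous_on C T"
  shows "closed (Fix C T)"
proof -
  have "closed (C \<inter> (\<lambda>x. T x - x) -` {0})"
    using assms by (intro continuous_closed_preimage continuous_intros) auto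
  moreover have "C \<inter> (\<lambda>x. T x - x) -` {0} = Fix C T" by (auto simp: Fix_def)
  ultimately show ?thesis by simp
qed

text \<open>On the compact set of points where the inner product is at most \<open>- \<epsilon>\<close>, the continuous residual
  never vanishes by the variational inequality, so it has a positive minimum.\<close>

lemma almost_fixed_inner_lower_bound:
  fixes P :: "'a::euclidean_space set"
  assumes P: "closed P" and T: "continuous_on P T"
    and vi: "\<And>y. y \<in> Fix P T \<Longrightarrow> 0 \<le> g \<bullet> (y - z)" and \<epsilon>: "0 < \<epsilon>"
  obtains \<delta> where "0 < \<delta>"
    "\<And>x. x \<in> P \<Longrightarrow> norm x \<le> R \<Longrightarrow> norm (x - T x) \<le> \<delta> \<Longrightarrow> - \<epsilon> \<le> g \<bullet> (x - z)"
proof -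
  define K where "K = P \<inter> (cball 0 R \<inter> {x. g \<bullet> x \<le> g \<bullet> z - \<epsilon>})"
  have K: "compact K"
    unfolding K_def using P
    by (intro closed_Int_compact compact_Int_closed closed_halfspace_le) auto
  show ?thesis
  proof (cases "K = {}")
    case True
    then have "- \<epsilon> \<le> g \<bullet> (x - z)" if "x \<in> P" "norm x \<le> R" for x
      using that by (force simp: K_def inner_diff_right)
    then show ?thesis using that[of 1] by simp
  next
    case False
    have "continuous_on K (\<lambda>x. norm (x - T x))"
      by (intro continuous_intros continuous_on_subset[OF T]) (simp add: K_def)
    then obtain x0 where x0: "x0 \<in> K" "\<And>x. x \<in> K \<Longrightarrow> norm (x0 - T x0) \<le> norm (x - T x)"
      using continuous_attains_inf[OF K False] by blast
    have "x0 \<notin> Fix P T"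
      using vi[of x0] x0(1) \<epsilon> by (auto simp: K_def inner_diff_right)
    with x0(1) have pos: "0 < norm (x0 - T x0)" by (auto simp: K_def Fix_def)
    show ?thesis
    proof (rule that[of "norm (x0 - T x0) / 2"])
      fix x assume x: "x \<in> P" "norm x \<le> R" "norm (x - T x) \<le> norm (x0 - T x0) / 2"
      then have "x \<notin> K" using x0(2)[of x] pos by auto
      with x show "- \<epsilon> \<le> g \<bullet> (x - z)" by (auto simp: K_def inner_diff_right)
    qed (use pos in simp)
  qed
qed

section \<open>Convergence of the iteration\<close>

lemma contraction_recursion_bounded:
  fixes d s :: "nat \<Rightarrow> real"
  assumes rec: "\<forall>\<^sub>F k in sequentially. 0 \<le> s k \<and> s k \<le> 1 \<and> d (Suc k) \<le> (1 - s k) * d k + s k * e"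
  obtains B where "\<And>k. d k \<le> B"
proof -
  obtain N where N: "\<And>k. k \<ge> N \<Longrightarrow> 0 \<le> s k \<and> s k \<le> 1 \<and> d (Suc k) \<le> (1 - s k) * d k + s k * e"
    using rec unfolding eventually_sequentially by blast
  define B where "B = max e (Max (d ` {..N}))"
  have "d k \<le> B" for k
  proof (induction k)
    case 0
    then show ?case by (simp add: B_def max.coboundedI2)
  next
    case (Suc k)
    show ?case
    proof (cases "k \<ge> N")
      case True
      then have "d (Suc k) \<le> (1 - s k) * B + s k * B"
        using N[OF True] Suc
        by (intro order_trans[OF conjunct2[OF conjunct2[OF N[OF True]]]] add_mono mult_left_mono)
          (auto simp: B_def)
      then show ?thesis by (simp add: algebra_simps)
    next
      case False
      then have "d (Suc k) \<le> Max (d ` {..N})" by (intro Max_ge) auto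
      then show ?thesis by (simp add: B_def)
    qed
  qed
  then show ?thesis by (rule that)
qed

text \<open>The excess of \<open>d\<close> over \<open>e\<close> is multiplied by at most \<open>1 - s k \<le> exp (- s k)\<close> per step, and the
  exponents sum to infinity.\<close>

lemma contraction_recursion_eventually_le:
  fixes d s :: "nat \<Rightarrow> real"
  assumes rec: "\<forall>\<^sub>F k in sequentially. 0 \<le> s k \<and> s k \<le> 1 \<and> d (Suc k) \<le> (1 - s k) * d k + s k * e"
    and s: "filterlim (\<lambda>n. \<Sum>k=1..n. s k) at_top sequentially" and \<epsilon>: "0 < \<epsilon>"
  shows "\<forall>\<^sub>F k in sequentially. d k \<le> e + \<epsilon>"
proof -
  obtain N where N: "\<And>k. k \<ge> N \<Longrightarrow> 0 \<le> s k \<and> s k \<le> 1 \<and> d (Suc k) \<le> (1 - s k) * d k + s k * e"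
    using rec unfolding eventually_sequentially by blast
  define C where "C = \<bar>d (Suc N) - e\<bar> * exp (\<Sum>k=1..N. s k)"
  have C: "d (Suc n) - e \<le> C * exp (- (\<Sum>k=1..n. s k))" if "n \<ge> N" for n
    using that
  proof (induction n rule: dec_induct)
    case base
    then show ?case by (simp add: C_def mult.assoc flip: exp_add)
  next
    case (step n)
    let ?s = "s (Suc n)"
    have s: "0 \<le> ?s" "?s \<le> 1" "d (Suc (Suc n)) \<le> (1 - ?s) * d (Suc n) + ?s * e"
      using N[of "Suc n"] step by auto
    have "d (Suc (Suc n)) - e \<le> (1 - ?s) * (d (Suc n) - e)"
      using s(3) by (simp add: algebra_simps)
    also have "\<dots> \<le> (1 - ?s) * (C * exp (- (\<Sum>k=1..n. s k)))"
      using step.IH s by (intro mult_left_mono) auto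
    also have "\<dots> \<le> exp (- ?s) * (C * exp (- (\<Sum>k=1..n. s k)))"
      using exp_ge_add_one_self[of "- ?s"] by (intro mult_right_mono) (auto simp: C_def)
    also have "\<dots> = C * exp (- (\<Sum>k=1..Suc n. s k))"
      by (simp add: exp_diff exp_minus field_simps exp_add)
    finally show ?case .
  qed
  have "((\<lambda>n. C * exp (- (\<Sum>k=1..n. s k))) \<longlongrightarrow> C * 0) sequentially"
    by (intro tendsto_intros filterlim_compose[OF exp_at_bot]
        filterlim_compose[OF filterlim_uminus_at_bot_at_top s])
  then have "\<forall>\<^sub>F n in sequentially. C * exp (- (\<Sum>k=1..n. s k)) < \<epsilon>"
    using \<epsilon> by (intro order_tendstoD) auto
  then have "\<forall>\<^sub>F n in sequentially. d (Suc n) \<le> e + \<epsilon>"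
    using eventually_ge_at_top[of N]
  proof eventually_elim
    case (elim n)
    then show ?case using C[of n] by simp
  qed
  then show ?thesis by (rule eventually_sequentially_Suc[THEN iffD1])
qed

text \<open>Both points being combined are compared with \<open>y\<close> separately: the gradient step through
  nonexpansiveness of the projection, which fixes \<open>y\<close>, and \<open>t\<close>, which stands for the image of \<open>x\<close>
  under an averaged map fixing \<open>y\<close>, through the hypothesis.\<close>

lemma averaged_gradient_step:
  fixes x y g :: "'a::euclidean_space"
  assumes P: "closed P" "convex P" "y \<in> P" and l: "0 \<le> l" "l \<le> 1"
    and T: "(norm (t - y))\<^sup>2 \<le> (norm (x - y))\<^sup>2 - r"
  shows "(norm (l *\<^sub>R closest_point P (x - a *\<^sub>R g) + (1 - l) *\<^sub>R t - y))\<^sup>2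
    \<le> (norm (x - y))\<^sup>2 - 2 * (l * a) * (g \<bullet> (x - y)) + l * a * (a * (norm g)\<^sup>2) - (1 - l) * r"
proof -
  let ?q = "closest_point P (x - a *\<^sub>R g)"
  have "norm (?q - y) \<le> norm (x - a *\<^sub>R g - y)"
    using closest_point_lipschitz[OF P(2,1), of "x - a *\<^sub>R g" y] P(3)
    by (auto simp: dist_norm closest_point_self)
  then have "(norm (?q - y))\<^sup>2 \<le> (norm ((x - y) - a *\<^sub>R g))\<^sup>2"
    by (simp add: algebra_simps power_mono)
  also have "\<dots> = (norm (x - y))\<^sup>2 - 2 * a * (g \<bullet> (x - y)) + a * (a * (norm g)\<^sup>2)"
    unfolding power2_norm_eq_inner
    by (simp add: inner_diff_left[of "x - y"] inner_diff_right[of _ "x - y"] inner_commute)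
  finally have q: "(norm (?q - y))\<^sup>2 \<le> \<dots>" .
  have "l *\<^sub>R ?q + (1 - l) *\<^sub>R t - y = l *\<^sub>R (?q - y) + (1 - l) *\<^sub>R (t - y)"
    by (simp add: algebra_simps)
  then have "(norm (l *\<^sub>R ?q + (1 - l) *\<^sub>R t - y))\<^sup>2
      \<le> l * (norm (?q - y))\<^sup>2 + (1 - l) * (norm (t - y))\<^sup>2"
    using l by (simp add: power2_norm_convex_combination)
  with mult_left_mono[OF q l(1)] mult_left_mono[OF T, of "1 - l"] l show ?thesis
    by (simp add: algebra_simps)
qed

text \<open>Young's inequality with weight \<open>\<sigma>\<close>, from the square of \<open>\<sigma> *\<^sub>R d + g\<close>; it absorbs a linear term
  into the quadratic one of strong monotonicity.\<close>

lemma young_inner_lower_bound: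
  fixes g d :: "'a::real_inner"
  assumes \<sigma>: "0 < \<sigma>"
  shows "- (\<sigma> * (norm d)\<^sup>2 + (norm g)\<^sup>2 / \<sigma>) \<le> 2 * (g \<bullet> d)"
proof -
  have "0 \<le> (norm (\<sigma> *\<^sub>R d + g))\<^sup>2" by simp
  also have "\<dots> = \<sigma> * (\<sigma> * (norm d)\<^sup>2 + 2 * (g \<bullet> d) + (norm g)\<^sup>2 / \<sigma>)"
    unfolding power2_norm_eq_inner using \<sigma>
    by (simp add: inner_add_left inner_add_right inner_commute algebra_simps)
  finally show ?thesis using \<sigma> by (simp add: zero_le_mult_iff)
qed

text \<open>This is where the two scales of the iteration are separated. The distance recursion combines a
  drift of size \<open>w k = lam k * alp k\<close> towards \<open>z\<close>, spoiled only by the sign of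
  \<open>grad z \<bullet> (p k - z)\<close>, with a decrease proportional to the squared residual \<open>p k - T (p k)\<close>. If the
  residual is small, \<open>p k\<close> is almost a fixed point and the bad term is almost nonnegative by the
  variational inequality. If it is not small, the decrease is bounded below and beats every term of
  size \<open>w k\<close>, since \<open>w k\<close> tends to zero. Either way the same scalar contraction holds.\<close>

theorem averaged_gradient_iteration_converges:
  fixes P :: "'a::euclidean_space set"
  assumes P: "closed P" "convex P"
    and T: "averaged_on P \<kappa> T" "0 < \<kappa>"
    and z: "z \<in> Fix P T" and vi: "\<And>y. y \<in> Fix P T \<Longrightarrow> 0 \<le> grad z \<bullet> (y - z)"
    and grad: "continuous_on P grad"
    and mono: "\<And>x. x \<in> P \<Longrightarrow> \<sigma> * (norm (x - z))\<^sup>2 \<le> (grad x - grad z) \<bullet> (x - z)" "0 < \<sigma>"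
    and lam: "\<And>k. k \<ge> 1 \<Longrightarrow> 0 \<le> lam k \<and> lam k \<le> 1" "lam \<longlonglongrightarrow> 0"
    and alp: "\<And>k. k \<ge> 1 \<Longrightarrow> 0 \<le> alp k" "alp \<longlonglongrightarrow> 0"
    and sum: "filterlim (\<lambda>n. \<Sum>k=1..n. lam k * alp k) at_top sequentially"
    and p: "\<And>k. k \<ge> 1 \<Longrightarrow> p k \<in> P"
    and step: "\<And>k. k \<ge> 1 \<Longrightarrow> p (Suc k) =
        lam k *\<^sub>R closest_point P (p k - alp k *\<^sub>R grad (p k)) + (1 - lam k) *\<^sub>R T (p k)"
    and nb: "no_blow_up P grad p"
  shows "p \<longlonglongrightarrow> z"
proof -
  define a where "a k = (norm (p k - z))\<^sup>2" for k
  define b where "b k = grad z \<bullet> (p k - z)" for k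
  define w where "w k = lam k * alp k" for k
  define r where "r k = norm (p k - T (p k))" for k
  have zP: "z \<in> P" using z by (simp add: Fix_def)
  have w_nonneg: "0 \<le> w k" if "k \<ge> 1" for k
    using lam(1)[OF that] alp(1)[OF that] by (simp add: w_def)
  have w: "w \<longlonglongrightarrow> 0"
    using tendsto_mult[OF lam(2) alp(2)] by (simp add: w_def[abs_def])
  have sum_scaled: "filterlim (\<lambda>n. \<Sum>k=1..n. C * w k) at_top sequentially" if "C > 0" for C
    using filterlim_tendsto_pos_mult_at_top[OF tendsto_const that sum]
    by (simp add: w_def sum_distrib_left)
  have rec: "a (Suc k) \<le> a k - 2 * w k * (\<sigma> * a k + b k)
      + w k * (alp k * (norm (grad (p k)))\<^sup>2) - (1 - lam k) * (\<kappa> * (r k)\<^sup>2)" if k: "k \<ge> 1" for k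
  proof -
    have "\<sigma> * a k + b k \<le> grad (p k) \<bullet> (p k - z)"
      using mono(1)[OF p[OF k]] by (simp add: a_def b_def inner_diff_left)
    then have "2 * w k * (\<sigma> * a k + b k) \<le> 2 * w k * (grad (p k) \<bullet> (p k - z))"
      using w_nonneg[OF k] by (intro mult_left_mono) auto
    moreover have "a (Suc k) \<le> a k - 2 * w k * (grad (p k) \<bullet> (p k - z))
      + w k * (alp k * (norm (grad (p k)))\<^sup>2) - (1 - lam k) * (\<kappa> * (r k)\<^sup>2)"
      unfolding a_def w_def r_def step[OF k] using lam(1)[OF k]
      by (intro averaged_gradient_step[OF P zP] averaged_on_fixed_point[OF T(1) p[OF k] z]) auto
    ultimately show ?thesis by linarith
  qed
  have "\<exists>R. \<forall>k\<ge>1. norm (p k) \<le> R"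
    using nb unfolding no_blow_up_def
  proof
    assume "bounded (p ` {1..})"
    then show ?thesis by (auto simp: bounded_iff)
  next
    assume "\<exists>L. \<forall>x\<in>P. norm (grad x) \<le> L * (1 + norm x)"
    then obtain L where L: "\<And>x. x \<in> P \<Longrightarrow> norm (grad x) \<le> L * (1 + norm x)" by blast
    \<comment> \<open>Linear growth makes the error \<open>alp k * (norm (grad (p k)))\<^sup>2\<close> at most a constant plus a small
      multiple of \<open>a k\<close>. Strong monotonicity provides \<open>2 * \<sigma> * a k\<close>; one half of it pays for the inner
      product with \<open>grad z\<close>, a quarter for this error, and the last quarter keeps \<open>a\<close> bounded.\<close>
    define E where "E = 2 * L\<^sup>2"
    define H where "H = (1 + norm z)\<^sup>2"
    define G where "G = (norm (grad z))\<^sup>2 / \<sigma>"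
    have E: "0 \<le> E" and H: "0 \<le> H" by (simp_all add: E_def H_def)
    have growth: "(norm (grad (p k)))\<^sup>2 \<le> E * (H + a k)" if "k \<ge> 1" for k
    proof -
      have "(norm (grad (p k)))\<^sup>2 \<le> (L * (1 + norm (p k)))\<^sup>2"
        using L[OF p[OF that]] by (intro power_mono) auto
      also have "\<dots> \<le> L\<^sup>2 * ((1 + norm z) + norm (p k - z))\<^sup>2"
        unfolding power_mult_distrib
        using norm_triangle_sub[of "p k" z] by (intro mult_left_mono power_mono) auto
      also have "\<dots> \<le> L\<^sup>2 * (2 * (1 + norm z)\<^sup>2 + 2 * (norm (p k - z))\<^sup>2)"
        using power2_norm_add_le[of "1 + norm z" "norm (p k - z)"]
        by (intro mult_left_mono) auto
      finally show ?thesis by (simp add: E_def H_def a_def algebra_simps)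
    qed
    have lim: "(\<lambda>k. alp k * E) \<longlonglongrightarrow> 0 * E" "(\<lambda>k. \<sigma> / 2 * w k) \<longlonglongrightarrow> \<sigma> / 2 * 0"
      by (intro tendsto_intros alp w)+
    have ev: "\<forall>\<^sub>F k in sequentially. alp k * E < \<sigma> / 2" "\<forall>\<^sub>F k in sequentially. \<sigma> / 2 * w k < 1"
      "\<forall>\<^sub>F k in sequentially. alp k < 1"
      by (rule order_tendstoD(2)[OF lim(1)] order_tendstoD(2)[OF lim(2)] order_tendstoD(2)[OF alp(2)];
          use mono(2) in simp)+
    have "\<forall>\<^sub>F k in sequentially. 0 \<le> \<sigma> / 2 * w k \<and> \<sigma> / 2 * w k \<le> 1 \<and>
        a (Suc k) \<le> (1 - \<sigma> / 2 * w k) * a k + \<sigma> / 2 * w k * (2 / \<sigma> * (G + E * H))"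
      using ev eventually_ge_at_top[of 1]
    proof eventually_elim
      case (elim k)
      have ak: "0 \<le> a k" by (simp add: a_def)
      have "alp k * (norm (grad (p k)))\<^sup>2 \<le> alp k * (E * (H + a k))"
        using growth[of k] alp(1)[of k] elim by (intro mult_left_mono) auto
      also have "\<dots> = alp k * (E * H) + (alp k * E) * a k" by (simp add: algebra_simps)
      also have "\<dots> \<le> 1 * (E * H) + \<sigma> / 2 * a k"
        using elim ak E H by (intro add_mono mult_right_mono) auto
      finally have g: "alp k * (norm (grad (p k)))\<^sup>2 \<le> E * H + \<sigma> / 2 * a k" by simp
      have "- (\<sigma> * a k + G) \<le> 2 * b k"
        using young_inner_lower_bound[OF mono(2), of "p k - z" "grad z"] by (simp add: a_def b_def G_def)
      with g have "- 2 * (\<sigma> * a k + b k) + alp k * (norm (grad (p k)))\<^sup>2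
          \<le> - (\<sigma> / 2) * a k + (G + E * H)"
        by simp
      then have "w k * (- 2 * (\<sigma> * a k + b k) + alp k * (norm (grad (p k)))\<^sup>2)
          \<le> w k * (- (\<sigma> / 2) * a k + (G + E * H))"
        using w_nonneg elim by (intro mult_left_mono) auto
      moreover have "0 \<le> (1 - lam k) * (\<kappa> * (r k)\<^sup>2)"
        using lam(1)[of k] elim T(2) by simp
      ultimately have "a (Suc k) \<le> a k + w k * (- (\<sigma> / 2) * a k + (G + E * H))"
        using rec[of k] elim by (simp add: algebra_simps)
      also have "\<dots> = (1 - \<sigma> / 2 * w k) * a k + \<sigma> / 2 * w k * (2 / \<sigma> * (G + E * H))"
        using mono(2) by (simp add: field_simps)
      finally show ?case using elim w_nonneg[of k] mono(2) by simp
    qed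
    then obtain B where B: "\<And>k. a k \<le> B"
      by (rule contraction_recursion_bounded[of "\<lambda>k. \<sigma> / 2 * w k" a]) blast
    have "norm (p k) \<le> norm z + sqrt B" for k
      using norm_triangle_sub[of "p k" z] real_le_rsqrt[OF B[of k, unfolded a_def]] by simp
    then show ?thesis by blast
  qed
  then obtain R where R: "\<And>k. k \<ge> 1 \<Longrightarrow> norm (p k) \<le> R" by blast
  have "compact (P \<inter> cball 0 R)" using P by (intro closed_Int_compact) auto
  then have "bounded (grad ` (P \<inter> cball 0 R))"
    by (intro compact_imp_bounded compact_continuous_image continuous_on_subset[OF grad]) auto
  then obtain G where "\<forall>x\<in>P \<inter> cball 0 R. norm (grad x) \<le> G"
    by (auto simp: bounded_iff)
  then have "norm (grad x) \<le> G" if "x \<in> P" "norm x \<le> R" for x using that by simp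
  then have G: "(norm (grad (p k)))\<^sup>2 \<le> G\<^sup>2" if "k \<ge> 1" for k
    using p[OF that] R[OF that] by (intro power_mono) auto
  define B where "B = norm (grad z) * (R + norm z)"
  have B: "- B \<le> b k" if "k \<ge> 1" for k
  proof -
    have "\<bar>b k\<bar> \<le> norm (grad z) * norm (p k - z)"
      unfolding b_def by (rule Cauchy_Schwarz_ineq2)
    also have "\<dots> \<le> B"
      unfolding B_def using R[OF that] norm_triangle_ineq4[of "p k" z]
      by (intro mult_left_mono) auto
    finally show ?thesis by simp
  qed
  have small: "\<forall>\<^sub>F k in sequentially. a k \<le> \<epsilon>" if \<epsilon>: "\<epsilon> > 0" for \<epsilon>
  proof -
    \<comment> \<open>Three errors of size \<open>w k * \<epsilon>'\<close> occur per step, which the contraction at rate \<open>2 * \<sigma> * w k\<close>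
      turns into the limiting level \<open>3 * \<epsilon>' / (2 * \<sigma>) = \<epsilon> / 2\<close>.\<close>
    define \<epsilon>' where "\<epsilon>' = \<sigma> * \<epsilon> / 3"
    have \<epsilon>': "\<epsilon>' > 0" using \<epsilon> mono(2) by (simp add: \<epsilon>'_def)
    obtain \<delta> where \<delta>: "0 < \<delta>"
      "\<And>x. x \<in> P \<Longrightarrow> norm x \<le> R \<Longrightarrow> norm (x - T x) \<le> \<delta> \<Longrightarrow> - \<epsilon>' \<le> grad z \<bullet> (x - z)"
      using almost_fixed_inner_lower_bound[OF P(1) averaged_on_continuous[OF T(1)] vi \<epsilon>'] T(2)
      by (metis less_imp_le)
    have lim: "(\<lambda>k. alp k * G\<^sup>2) \<longlonglongrightarrow> 0 * G\<^sup>2" "(\<lambda>k. 2 * \<sigma> * w k) \<longlonglongrightarrow> 2 * \<sigma> * 0"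
      "(\<lambda>k. 2 * B * w k) \<longlonglongrightarrow> 2 * B * 0"
      by (intro tendsto_intros alp w)+
    have gap: "0 < \<kappa> * \<delta>\<^sup>2 / 2" using T(2) \<delta> by simp
    have ev: "\<forall>\<^sub>F k in sequentially. alp k * G\<^sup>2 < \<epsilon>'"
      "\<forall>\<^sub>F k in sequentially. 2 * \<sigma> * w k < 1"
      "\<forall>\<^sub>F k in sequentially. 2 * B * w k < \<kappa> * \<delta>\<^sup>2 / 2"
      "\<forall>\<^sub>F k in sequentially. lam k < 1 / 2"
      by (rule order_tendstoD(2)[OF lim(1)] order_tendstoD(2)[OF lim(2)] order_tendstoD(2)[OF lim(3)]
          order_tendstoD(2)[OF lam(2)]; use \<epsilon>' gap in simp)+
    have "\<forall>\<^sub>F k in sequentially. 0 \<le> 2 * \<sigma> * w k \<and> 2 * \<sigma> * w k \<le> 1 \<and>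
        a (Suc k) \<le> (1 - 2 * \<sigma> * w k) * a k + 2 * \<sigma> * w k * (\<epsilon> / 2)"
      using ev eventually_ge_at_top[of 1]
    proof eventually_elim
      case (elim k)
      have k: "k \<ge> 1" using elim by simp
      have "alp k * (norm (grad (p k)))\<^sup>2 \<le> alp k * G\<^sup>2"
        using G[OF k] alp(1)[OF k] by (intro mult_left_mono) auto
      then have g: "w k * (alp k * (norm (grad (p k)))\<^sup>2) \<le> w k * \<epsilon>'"
        using elim w_nonneg[OF k] by (intro mult_left_mono) auto
      \<comment> \<open>Near the fixed point set the inner product is almost nonnegative; away from it the residual
        term dominates.\<close>
      have far_near: "- 2 * w k * b k - (1 - lam k) * (\<kappa> * (r k)\<^sup>2) \<le> 2 * w k * \<epsilon>'"
      proof (cases "r k \<le> \<delta>")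
        case True
        then have "- \<epsilon>' \<le> b k"
          using \<delta>(2)[OF p[OF k] R[OF k]] by (simp add: r_def b_def)
        then have "2 * w k * (- \<epsilon>') \<le> 2 * w k * b k"
          using w_nonneg[OF k] by (intro mult_left_mono) auto
        moreover have "0 \<le> (1 - lam k) * (\<kappa> * (r k)\<^sup>2)" using lam(1)[OF k] T(2) by simp
        ultimately show ?thesis by (simp add: algebra_simps)
      next
        case False
        then have "\<kappa> * \<delta>\<^sup>2 \<le> \<kappa> * (r k)\<^sup>2"
          using \<delta>(1) T(2) by (intro mult_left_mono power_mono) auto
        then have "1 / 2 * (\<kappa> * \<delta>\<^sup>2) \<le> (1 - lam k) * (\<kappa> * (r k)\<^sup>2)"
          using elim T(2) by (intro mult_mono) auto
        moreover have "2 * w k * (- B) \<le> 2 * w k * b k"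
          using B[OF k] w_nonneg[OF k] by (intro mult_left_mono) auto
        moreover have "0 \<le> w k * \<epsilon>'" using w_nonneg[OF k] \<epsilon>' by simp
        ultimately show ?thesis using elim by (simp add: mult.commute mult.left_commute)
      qed
      have "a (Suc k) \<le> a k - 2 * w k * \<sigma> * a k + 3 * w k * \<epsilon>'"
        using rec[OF k] g far_near by (simp add: algebra_simps)
      with elim w_nonneg[OF k] mono(2) show ?case by (simp add: \<epsilon>'_def algebra_simps)
    qed
    from contraction_recursion_eventually_le[OF this sum_scaled, of "\<epsilon> / 2"] mono(2) \<epsilon>
    show ?thesis by simp
  qed
  show ?thesis
  proof (rule tendstoI)
    fix e :: real assume e: "e > 0"
    then have "\<forall>\<^sub>F k in sequentially. a k \<le> (e / 2)\<^sup>2" by (intro small) simp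
    then show "\<forall>\<^sub>F k in sequentially. dist (p k) z < e"
    proof eventually_elim
      case (elim k)
      then have "norm (p k - z) \<le> e / 2" unfolding a_def using e by (simp add: power2_le_iff_abs_le)
      with e show ?case by (simp add: dist_norm)
    qed
  qed
qed

section \<open>Excess supply and the stopping rule\<close>

text \<open>Supply minimizes \<open>c\<close> perturbed by the linear term \<open>- p\<close> and demand minimizes \<open>t\<close> perturbed by
  \<open>p\<close>, so the map \<open>p\<close> to supply and the map \<open>p\<close> to minus demand are cocoercive with constants
  \<open>2 * \<mu>c\<close> and \<open>2 * \<mu>t\<close>. Adding two cocoercive maps costs the factor 2 of the parallelogram bound,
  which leaves \<open>min \<mu>c \<mu>t\<close>.\<close>

lemma excess_supply_cocoercive:
  fixes X U :: "(real^'n) set" and c t u :: "real^'n \<Rightarrow> real"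
  assumes X: "convex X" "X \<subseteq> U"
    and c: "strongly_convex_on U \<mu>c c" and t: "strongly_convex_on U \<mu>t t"
    and u: "convex_on X (\<lambda>x. - u x)"
    and supply_ex1: "\<And>p. p \<in> P \<Longrightarrow> \<exists>!x. supply_opt X c p x"
    and demand_ex1: "\<And>p. p \<in> P \<Longrightarrow> \<exists>!x. demand_opt X t u M p x"
    and F: "F = (\<lambda>p. supply_fun X c p - demand_fun X t u M p)"
    and x: "x \<in> P" and y: "y \<in> P"
  shows "min \<mu>c \<mu>t * (norm (F x - F y))\<^sup>2 \<le> (x - y) \<bullet> (F x - F y)"
proof -
  let ?S = "supply_fun X c" and ?D = "demand_fun X t u M"
  define Y where "Y = {x \<in> X. M \<le> u x}"
  have Y: "convex Y" "Y \<subseteq> U"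
  proof -
    show "Y \<subseteq> U" using X(2) by (auto simp: Y_def)
    show "convex Y"
    proof (rule convexI)
      fix x y and v w :: real
      assume xy: "x \<in> Y" "y \<in> Y" and vw: "0 \<le> v" "0 \<le> w" "v + w = 1"
      then have "v *\<^sub>R x + w *\<^sub>R y \<in> X" using X(1) by (auto simp: Y_def convexD)
      moreover have "- u (v *\<^sub>R x + w *\<^sub>R y) \<le> max (- u x) (- u y)"
        using xy vw by (intro convex_lower[OF u]) (auto simp: Y_def)
      ultimately show "v *\<^sub>R x + w *\<^sub>R y \<in> Y" using xy by (auto simp: Y_def)
    qed
  qed
  have S: "is_arg_min (\<lambda>x. (- p) \<bullet> x + c x) (\<lambda>x. x \<in> X) (?S p)" if "p \<in> P" for p
  proof -
    have "supply_opt X c p (?S p)"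
      unfolding supply_fun_def by (rule theI'[OF supply_ex1[OF that]])
    then show ?thesis by (force simp: supply_opt_def is_arg_max_def is_arg_min_def)
  qed
  have D: "is_arg_min (\<lambda>x. p \<bullet> x + t x) (\<lambda>x. x \<in> Y) (?D p)" if "p \<in> P" for p
    using theI'[OF demand_ex1[OF that]] by (simp add: demand_fun_def demand_opt_def Y_def)
  let ?a = "?S x - ?S y" and ?b = "?D y - ?D x"
  let ?m = "min \<mu>c \<mu>t"
  have "2 * \<mu>c * (norm ?a)\<^sup>2 \<le> (x - y) \<bullet> ?a"
    using parametric_minimizer_cocoercive[OF c X S[OF x] S[OF y]]
    by (simp add: inner_diff_left)
  moreover have "2 * \<mu>t * (norm ?b)\<^sup>2 \<le> (x - y) \<bullet> ?b"
    by (rule parametric_minimizer_cocoercive[OF t Y D[OF y] D[OF x]])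
  moreover have "?m * (norm ?a)\<^sup>2 \<le> \<mu>c * (norm ?a)\<^sup>2" "?m * (norm ?b)\<^sup>2 \<le> \<mu>t * (norm ?b)\<^sup>2"
    by (intro mult_right_mono; simp)+
  moreover have "?m * (norm (?a + ?b))\<^sup>2 \<le> ?m * (2 * (norm ?a)\<^sup>2 + 2 * (norm ?b)\<^sup>2)"
    using c t by (intro mult_left_mono power2_norm_add_le) (simp add: strongly_convex_on_def)
  moreover have "(x - y) \<bullet> (?a + ?b) = (x - y) \<bullet> ?a + (x - y) \<bullet> ?b" by (rule inner_add_right)
  ultimately have "?m * (norm (?a + ?b))\<^sup>2 \<le> (x - y) \<bullet> (?a + ?b)"
    unfolding distrib_left by linarith
  moreover have "F x - F y = ?a + ?b" by (simp add: F)
  ultimately show ?thesis by simp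
qed

text \<open>A later success of the stopping test would entail a first one, at which the run ends.\<close>

lemma no_termination_reaches:
  assumes "\<nexists>k. terminates_at p q k" "1 \<le> k"
  shows "reaches p q k"
proof -
  have "\<nexists>k. 1 \<le> k \<and> stop_test p q k"
    using assms(1) exists_least_iff[of "\<lambda>k. 1 \<le> k \<and> stop_test p q k"]
    by (auto simp: terminates_at_def reaches_def)
  with assms(2) show ?thesis by (auto simp: reaches_def)
qed

theorem theorem4p1:
  fixes P X U :: "(real^'n) set"
    and c t u f :: "real^'n \<Rightarrow> real"
    and grad :: "real^'n \<Rightarrow> real^'n"
    and F T :: "real^'n \<Rightarrow> real^'n"
    and \<mu>c \<mu>t \<mu>F M \<eta> :: real
    and lam alp :: "nat \<Rightarrow> real"
    and p q :: "nat \<Rightarrow> real^'n"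
  assumes P: "P \<noteq> {}" "closed P" "convex P"
    and X: "closed X" "convex X" "X \<subseteq> {x. \<forall>i. 0 \<le> x $ i}"
    and U: "open U" "convex U" "X \<subseteq> U"
    and c: "c differentiable_on U" "strongly_convex_on U \<mu>c c"
    and t: "t differentiable_on U" "strongly_convex_on U \<mu>t t"
    and u: "convex_on X (\<lambda>x. - u x)"
    and M: "M > 0"
    and supply_ex1: "\<And>p. p \<in> P \<Longrightarrow> \<exists>!x. supply_opt X c p x"
    and demand_ex1: "\<And>p. p \<in> P \<Longrightarrow> \<exists>!x. demand_opt X t u M p x"
    and F: "F = (\<lambda>p. supply_fun X c p - demand_fun X t u M p)"
    and \<mu>F: "\<mu>F = 1/2 * min \<mu>c \<mu>t"
    and \<eta>: "0 \<le> \<eta>" "\<eta> \<le> 2 * \<mu>F"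
    and T: "T = proj_step P \<eta> F"
    and f_strongly_convex: "\<exists>\<gamma>. strongly_convex_on UNIV \<gamma> f"
    and f_C1: "\<And>x. GDERIV f x :> grad x" "continuous_on UNIV grad"
    and Fix_nonempty: "Fix P T \<noteq> {}"
    and lam: "\<And>k. k \<ge> 1 \<Longrightarrow> lam k > 0" "antimono_on {1..} lam" "lam \<longlonglongrightarrow> 0"
    and alp: "\<And>k. k \<ge> 1 \<Longrightarrow> alp k > 0" "antimono_on {1..} alp" "alp \<longlonglongrightarrow> 0"
    and lam_alp_sum: "filterlim (\<lambda>n. \<Sum>k=1..n. lam k * alp k) at_top sequentially"
    and lam_var: "(\<lambda>k. \<bar>lam (Suc k) - lam k\<bar>) summable_on {1..}"
    and alp_var: "(\<lambda>k. \<bar>alp (Suc k) - alp k\<bar>) summable_on {1..}"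
    and lam_le_1: "\<And>k. k \<ge> 1 \<Longrightarrow> lam k \<le> 1"
    and run: "algorithm_run P grad T lam alp p q"
  shows "(\<exists>!x. BOP_solution f P T x) \<and>
         (\<forall>k. terminates_at p q k \<and> lam k \<noteq> 1 \<longrightarrow> BOP_solution f P T (p k)) \<and>
         ((\<nexists>k. terminates_at p q k) \<and> no_blow_up P grad p \<longrightarrow>
            (\<forall>k\<ge>1. p k \<in> P) \<and> (\<exists>x. BOP_solution f P T x \<and> p \<longlonglongrightarrow> x))"
proof -
  obtain \<gamma> where sc: "strongly_convex_on UNIV \<gamma> f" using f_strongly_convex by blast
  then have \<gamma>: "\<gamma> > 0" by (simp add: strongly_convex_on_def)
  have \<eta>_le: "\<eta> \<le> min \<mu>c \<mu>t" using \<eta> \<mu>F by simp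
  have G: "averaged_on P 1 (\<lambda>x. x - \<eta> *\<^sub>R F x)"
    using excess_supply_cocoercive[OF X(2) U(3) c(2) t(2) u supply_ex1 demand_ex1 F]
    by (rule averaged_on_cocoercive_step[OF _ \<eta>(1) \<eta>_le])
  have T_av: "averaged_on P (1/2) T"
    using averaged_on_compose[OF G averaged_on_closest_point[OF P]]
    by (simp add: T proj_step_def[abs_def] comp_def)
  have T_in: "T x \<in> P" for x
    using P by (simp add: T proj_step_def closest_point_in_set)
  have Fix: "closed (Fix P T)" "convex (Fix P T)"
    using closed_Fix[OF P(2) averaged_on_continuous[OF T_av]] convex_Fix[OF P(3) T_av] by simp_all
  have ex1: "\<exists>!x. BOP_solution f P T x"
    unfolding BOP_solution_def
    by (rule strongly_convex_unique_minimizer[OF sc f_C1(1) Fix Fix_nonempty])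
  have run_q: "q k = closest_point P (p k - alp k *\<^sub>R grad (p k))"
    and run_p: "p (Suc k) = lam k *\<^sub>R q k + (1 - lam k) *\<^sub>R T (p k)" if "reaches p q k" for k
  proof -
    have "alp k > 0" using that alp(1) by (simp add: reaches_def)
    then show "q k = closest_point P (p k - alp k *\<^sub>R grad (p k))"
      using run that prox_argmin_iff_closest_point[OF P(2,3,1)]
      unfolding algorithm_run_def by blast
    show "p (Suc k) = lam k *\<^sub>R q k + (1 - lam k) *\<^sub>R T (p k)"
      using run that unfolding algorithm_run_def by blast
  qed
  have q_in: "q k \<in> P" if "reaches p q k" for k
    using run_q[OF that] P by (simp add: closest_point_in_set)
  have stop: "BOP_solution f P T (p k)" if ends: "terminates_at p q k" and ne: "lam k \<noteq> 1" for k
  proof -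
    have k: "reaches p q k" and eq: "q k = p k" "p (Suc k) = p k"
      using ends by (simp_all add: terminates_at_def stop_test_def)
    have a: "alp k > 0" using k alp(1) by (simp add: reaches_def)
    have pP: "p k \<in> P" using q_in[OF k] eq by simp
    have "T (p k) = p k \<or> lam k = 1"
      using run_p[OF k] unfolding eq by (simp add: algebra_simps)
    then have "T (p k) = p k" using ne by simp
    with pP have pFix: "p k \<in> Fix P T" by (simp add: Fix_def)
    \<comment> \<open>A fixed point of the projected gradient step minimizes \<open>f\<close> over all of \<open>P\<close>, in particular
      over the fixed points of \<open>T\<close>.\<close>
    have "f (p k) \<le> f y" if y: "y \<in> P" for y
    proof -
      have cp: "closest_point P (p k - alp k *\<^sub>R grad (p k)) = p k"
        using run_q[OF k] eq by simp
      have "(- alp k *\<^sub>R grad (p k)) \<bullet> (y - p k) \<le> 0"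
        using closest_point_dot[OF P(3,2) y, of "p k - alp k *\<^sub>R grad (p k)"] unfolding cp by simp
      then have "0 \<le> grad (p k) \<bullet> (y - p k)" using a by (simp add: zero_le_mult_iff)
      moreover have "0 \<le> \<gamma> * (norm (y - p k))\<^sup>2" using \<gamma> by simp
      ultimately show ?thesis
        using strongly_convex_on_gradient[OF sc UNIV_I UNIV_I f_C1(1), of "p k" y] by linarith
    qed
    with pFix show ?thesis by (simp add: BOP_solution_def is_arg_min_linorder Fix_def)
  qed
  have conv: "(\<forall>k\<ge>1. p k \<in> P) \<and> (\<exists>x. BOP_solution f P T x \<and> p \<longlonglongrightarrow> x)"
    if nt: "\<nexists>k. terminates_at p q k" and nb: "no_blow_up P grad p"
  proof -
    note reach = no_termination_reaches[OF nt]
    have pP: "p k \<in> P" if "k \<ge> 1" for k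
      using that
    proof (induction k rule: nat_induct_at_least)
      case base
      then show ?case using run by (simp add: algorithm_run_def)
    next
      case (Suc k)
      then show ?case
        using convexD[OF P(3) q_in[OF reach] T_in, of k "lam k" "1 - lam k" "p k"]
          lam(1)[of k] lam_le_1[of k] run_p[OF reach, of k] by simp
    qed
    obtain z where z: "BOP_solution f P T z" using ex1 by blast
    then have zF: "z \<in> Fix P T" by (simp add: BOP_solution_def is_arg_min_linorder)
    have "p \<longlonglongrightarrow> z"
    proof (rule averaged_gradient_iteration_converges[OF P(2,3) T_av _ zF _ _ _ _ _ lam(3) _ alp(3)
          lam_alp_sum pP _ nb])
      show "0 \<le> grad z \<bullet> (y - z)" if "y \<in> Fix P T" for y
        using minimizer_variational_inequality[OF Fix(2) z[unfolded BOP_solution_def] that f_C1(1)] .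
      show "2 * \<gamma> * (norm (x - z))\<^sup>2 \<le> (grad x - grad z) \<bullet> (x - z)" for x
        using strongly_convex_on_gradient_monotone[OF sc UNIV_I UNIV_I f_C1(1) f_C1(1)] .
      show "p (Suc k) = lam k *\<^sub>R closest_point P (p k - alp k *\<^sub>R grad (p k)) + (1 - lam k) *\<^sub>R T (p k)"
        if "k \<ge> 1" for k
        using run_p[OF reach[OF that]] run_q[OF reach[OF that]] by simp
      show "0 \<le> lam k \<and> lam k \<le> 1" "0 \<le> alp k" if "k \<ge> 1" for k
        using lam(1)[OF that] lam_le_1[OF that] alp(1)[OF that] by auto
    qed (use \<gamma> f_C1(2) continuous_on_subset in auto)
    with pP z show ?thesis by blast
  qed
  from ex1 stop conv show ?thesis by blast
qed

end
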